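(* Let $m\ge 2$ be an even integer and let $\beta>1$ be a real number satisfying $\beta^m=\beta^{m-1}+\cdots+\beta+1$. Let $a_n=2^n\|\nu_\beta^{(n)}\|$ for $n\ge 0$. Then $$a_n=\begin{cases}2^n, & \text{if } 0\le n\le m,\\ 2a_{n-1}-2a_{n-m}+2a_{n-m-1}, & \text{if } n\ge m+1.\end{cases}$$ In particular, there exists a constant $C>0$ such that $$\|\nu_\beta^{(n)}\|\sim C\left(\frac{\lambda}{2}\right)^n\quad\text{as } n\to\infty,$$ where $\lambda\in(1,2)$ is the only real root of the equation $x^{m+1}=2x^m-2x+2$.
   Context: For $\beta>1$, the signed Bernoulli convolutions $\nu_\beta^{(n)}$ are the finite signed measures on $\mathbb{R}$ defined by $\nu_\beta^{(0)}=\delta_0$ and $\nu_\beta^{(n)}=\nu_\beta^{(n-1)}*\left(\frac12\delta_{\beta^{-n}}-\frac12\delta_{-\beta^{-n}}\right)$ for $n\ge 1$, where $\delta_x$ is the Dirac measure at $x$ and $*$ is convolution of measures. Equivalently, for $n\ge1$, $\nu_\beta^{(n)}=2^{-n}\sum_{\varepsilon\in\{\pm1\}^n}\varepsilon_1\cdots\varepsilon_n\,\delta_{\sum_{j=1}^n\varepsilon_j\beta^{-j}}$. $\|\cdot\|$ denotes the total variation norm of a signed measure. The notation $u_n\sim v_n$ means $u_n/v_n\to 1$. *)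

theory Defs
  imports "HOL-Probability.Probability"
begin

text \<open>
  A finite signed Borel measure on the real line is represented by its real-valued set function;
  only the values on Borel sets matter.
\<close>

type_synonym signed_measure = "real set \<Rightarrow> real"

definition dirac :: "real \<Rightarrow> signed_measure" where
  "dirac x = measure (return borel x)"

text \<open>
  Jordan decomposition: \<open>\<mu>\<^sup>+ A = sup {\<mu> B | B \<subseteq> A}\<close> and
  \<open>\<mu>\<^sup>- = (- \<mu>)\<^sup>+\<close>, with \<open>B\<close> ranging over Borel sets. For a countably additive
  real-valued \<open>\<mu>\<close> the suprema are finite, and both parts are finite measures with
  \<open>\<mu> = \<mu>\<^sup>+ - \<mu>\<^sup>-\<close>.
\<close>

definition pos_part :: "signed_measure \<Rightarrow> real measure" where
  "pos_part \<mu> = measure_of UNIV (sets borel)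
     (\<lambda>A. ennreal (SUP B \<in> {B \<in> sets borel. B \<subseteq> A}. \<mu> B))"

definition neg_part :: "signed_measure \<Rightarrow> real measure" where
  "neg_part \<mu> = pos_part (\<lambda>A. - \<mu> A)"

text \<open>Bilinear extension of the convolution of finite (positive) measures.\<close>

definition signed_convolution :: "signed_measure \<Rightarrow> signed_measure \<Rightarrow> signed_measure" where
  "signed_convolution \<mu> \<nu> = (\<lambda>A.
       measure (convolution (pos_part \<mu>) (pos_part \<nu>)) A
     - measure (convolution (pos_part \<mu>) (neg_part \<nu>)) A
     - measure (convolution (neg_part \<mu>) (pos_part \<nu>)) A
     + measure (convolution (neg_part \<mu>) (neg_part \<nu>)) A)"

definition tv_norm :: "signed_measure \<Rightarrow> real" where
  "tv_norm \<mu> = (SUP P \<in> {P. finite P \<and> P \<subseteq> sets borel \<and> disjoint P \<and> \<Union>P = UNIV}.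
     \<Sum>A\<in>P. \<bar>\<mu> A\<bar>)"

fun signed_bernoulli :: "real \<Rightarrow> nat \<Rightarrow> signed_measure" where
  "signed_bernoulli \<beta> 0 = dirac 0"
| "signed_bernoulli \<beta> (Suc n) = signed_convolution (signed_bernoulli \<beta> n)
     (\<lambda>A. 1/2 * dirac (1 / \<beta> ^ Suc n) A - 1/2 * dirac (- 1 / \<beta> ^ Suc n) A)"

end

theory Submission
  imports Defs
begin

text \<open>
  Up to sign and an affine change of variable, the masses of \<open>2^n \<nu>\<close> are the coefficients of
  the generalised polynomial \<open>\<Prod>j<n. 1 - X^(\<beta>^j)\<close>, so \<open>a n\<close> is the sum of their absolute
  values. Splitting off the top factor gives \<open>a (n + 1) = 2 * a n\<close> minus a cancellation term
  supported on the numbers having expansions with top digit \<open>1\<close> and with top digit \<open>0\<close>. As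
  \<open>\<beta>^n = \<beta>^(n-1) + \<dots> + \<beta>^(n-m)\<close>, such expansions must begin with \<open>1 0 \<dots> 0\<close> and
  \<open>0 1 \<dots> 1\<close> (\<open>m\<close> digits); deleting these prefixes expresses the cancellation through the
  polynomial with \<open>n + 1 - m\<close> factors, and there it evaluates to the two lower-order terms.
  In the normalised recurrence for \<open>a n / \<lambda>^n\<close> the increments satisfy a recurrence whose
  coefficients have absolute sum below \<open>1\<close>, so they are summable; an invariant linear form
  evaluates the limit and shows that it is positive.
\<close>

subsection \<open>Finitely supported signed measures\<close>

text \<open>The masses are summed over the whole line by \<open>has_sum\<close> rather than over a
  chosen support, so that translations and affine substitutions become plain reindexings.\<close>

definition has_masses :: "signed_measure \<Rightarrow> (real \<Rightarrow> real) \<Rightarrow> bool" where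
  "has_masses \<mu> w \<longleftrightarrow> finite {x. w x \<noteq> 0} \<and>
     (\<forall>A\<in>sets borel. ((\<lambda>x. w x * indicator A x) has_sum \<mu> A) UNIV)"

lemma has_masses_sum:
  assumes "has_masses \<mu> w" "finite S" "{x. w x \<noteq> 0} \<subseteq> S" "A \<in> sets borel"
  shows "\<mu> A = (\<Sum>x\<in>S. w x * indicator A x)"
proof (rule has_sum_unique)
  show "((\<lambda>x. w x * indicator A x) has_sum \<mu> A) UNIV"
    using assms by (simp add: has_masses_def)
  show "((\<lambda>x. w x * indicator A x) has_sum (\<Sum>x\<in>S. w x * indicator A x)) UNIV"
    by (rule has_sum_finite_neutralI[of S]) (use assms in auto)
qed

lemma has_massesI:
  assumes "finite S" "{x. w x \<noteq> 0} \<subseteq> S"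
    and "\<And>A. A \<in> sets borel \<Longrightarrow> \<mu> A = (\<Sum>x\<in>S. w x * indicator A x)"
  shows "has_masses \<mu> w"
  unfolding has_masses_def
proof (intro conjI ballI)
  show "finite {x. w x \<noteq> 0}"
    by (rule finite_subset[OF _ assms(1)]) (use assms(2) in auto)
  show "((\<lambda>x. w x * indicator A x) has_sum \<mu> A) UNIV" if "A \<in> sets borel" for A
    by (rule has_sum_finite_neutralI[of S]) (use assms that in auto)
qed

lemma has_masses_uminus:
  assumes "has_masses \<mu> w" shows "has_masses (\<lambda>A. - \<mu> A) (\<lambda>x. - w x)"
  using assms by (simp add: has_masses_def has_sum_uminus)

text \<open>The supremum is attained by the singletons of the support together with its complement.
  Other partitions give no more, by the triangle inequality and because each point lies in exactly
  one block.\<close>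

lemma tv_norm_masses:
  assumes "has_masses \<mu> w"
  shows "((\<lambda>x. \<bar>w x\<bar>) has_sum tv_norm \<mu>) UNIV"
proof -
  define S where "S = {x. w x \<noteq> 0}"
  have S: "finite S" "{x. w x \<noteq> 0} \<subseteq> S"
    using assms by (auto simp: S_def has_masses_def)
  note \<mu> = has_masses_sum[OF assms S]
  let ?PP = "{P. finite P \<and> P \<subseteq> sets borel \<and> disjoint P \<and> \<Union>P = (UNIV::real set)}"
  have "tv_norm \<mu> = (\<Sum>x\<in>S. \<bar>w x\<bar>)"
    unfolding tv_norm_def
  proof (rule cSup_eq_maximum)
    define P where "P = insert (- S) ((\<lambda>x. {x}) ` S)"
    have borel: "- S \<in> sets borel"
      using S(1) by (simp add: borel_comp finite_imp_closed)
    have "P \<in> ?PP"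
      using S(1) borel by (auto simp: P_def disjoint_def)
    moreover have "(\<Sum>A\<in>P. \<bar>\<mu> A\<bar>) = (\<Sum>x\<in>S. \<bar>w x\<bar>)"
    proof -
      have "\<mu> (- S) = 0"
        by (subst \<mu>[OF borel]) (auto intro!: sum.neutral)
      moreover have "\<mu> {x} = w x" if "x \<in> S" for x
      proof -
        have "\<mu> {x} = (\<Sum>y\<in>S. if y = x then w y else 0)"
          by (subst \<mu>) (auto intro!: sum.cong)
        then show ?thesis using that S(1) by simp
      qed
      moreover have "- S \<notin> (\<lambda>x. {x}) ` S"
        by auto
      ultimately show ?thesis
        using S(1) by (simp add: P_def sum.reindex)
    qed
    ultimately show "(\<Sum>x\<in>S. \<bar>w x\<bar>) \<in> (\<lambda>P. \<Sum>A\<in>P. \<bar>\<mu> A\<bar>) ` ?PP"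
      by (metis (no_types, lifting) image_eqI)
  next
    fix t assume "t \<in> (\<lambda>P. \<Sum>A\<in>P. \<bar>\<mu> A\<bar>) ` ?PP"
    then obtain P where P: "finite P" "P \<subseteq> sets borel" "disjoint P" "\<Union>P = UNIV"
      and t: "t = (\<Sum>A\<in>P. \<bar>\<mu> A\<bar>)" by auto
    have "t \<le> (\<Sum>A\<in>P. \<Sum>x\<in>S. \<bar>w x\<bar> * indicator A x)"
      unfolding t
    proof (rule sum_mono)
      fix A assume "A \<in> P"
      then have "\<mu> A = (\<Sum>x\<in>S. w x * indicator A x)" using P \<mu> by blast
      also have "\<bar>\<dots>\<bar> \<le> (\<Sum>x\<in>S. \<bar>w x * indicator A x\<bar>)" by (rule sum_abs)
      finally show "\<bar>\<mu> A\<bar> \<le> (\<Sum>x\<in>S. \<bar>w x\<bar> * indicator A x)" by (simp add: abs_mult)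
    qed
    also have "\<dots> = (\<Sum>x\<in>S. \<bar>w x\<bar> * (\<Sum>A\<in>P. indicator A x))"
      by (subst sum.swap) (simp add: sum_distrib_left)
    also have "\<dots> = (\<Sum>x\<in>S. \<bar>w x\<bar>)"
    proof (rule sum.cong)
      fix x
      obtain A where A: "A \<in> P" "x \<in> A" using P(4) by blast
      have "(\<Sum>B\<in>P. indicator B x) = (\<Sum>B\<in>P. if B = A then 1 else (0::real))"
        using A P(3) by (intro sum.cong) (auto simp: disjoint_def indicator_def)
      then show "\<bar>w x\<bar> * (\<Sum>B\<in>P. indicator B x) = \<bar>w x\<bar>" using A(1) P(1) by simp
    qed simp
    finally show "t \<le> (\<Sum>x\<in>S. \<bar>w x\<bar>)" .
  qed
  then show ?thesis
    by (intro has_sum_finite_neutralI[of S]) (use S in auto)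
qed

section \<open>Jordan parts and convolutions of atomic measures\<close>

text \<open>Pushing forward along the identity replaces the power set of \<open>S\<close> by the
  Borel sets as sigma-algebra.\<close>

definition point_masses :: "real set \<Rightarrow> (real \<Rightarrow> real) \<Rightarrow> real measure" where
  "point_masses S p = distr (point_measure S (\<lambda>x. ennreal (p x))) borel (\<lambda>x. x)"

lemma sets_point_masses [simp]: "sets (point_masses S p) = sets borel"
  and space_point_masses [simp]: "space (point_masses S p) = UNIV"
  by (simp_all add: point_masses_def)

lemma nn_integral_point_masses:
  assumes "finite S" "f \<in> borel_measurable borel"
  shows "(\<integral>\<^sup>+x. f x \<partial>point_masses S p) = (\<Sum>x\<in>S. ennreal (p x) * f x)"
  unfolding point_masses_def
  using assms by (simp add: nn_integral_distr nn_integral_point_measure_finite mult.commute)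

lemma emeasure_point_masses:
  assumes "finite S" "\<And>x. p x \<ge> 0" "A \<in> sets borel"
  shows "emeasure (point_masses S p) A = ennreal (\<Sum>x\<in>S. p x * indicator A x)"
proof -
  have "emeasure (point_masses S p) A = (\<integral>\<^sup>+x. indicator A x \<partial>point_masses S p)"
    using assms by simp
  also have "\<dots> = (\<Sum>x\<in>S. ennreal (p x) * indicator A x)"
    using assms by (intro nn_integral_point_masses) auto
  also have "\<dots> = (\<Sum>x\<in>S. ennreal (p x * indicator A x))"
    by (intro sum.cong) (auto simp: indicator_def)
  also have "\<dots> = ennreal (\<Sum>x\<in>S. p x * indicator A x)"
    using assms by (intro sum_ennreal) auto
  finally show ?thesis .
qed

lemma finite_measure_point_masses:
  assumes "finite S" "\<And>x. p x \<ge> 0"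
  shows "finite_measure (point_masses S p)"
  by (rule finite_measureI) (simp add: emeasure_point_masses assms)

text \<open>The supremum over Borel subsets of \<open>A\<close> is attained at the set of points of
  \<open>A\<close> with positive mass.\<close>

lemma pos_part_masses:
  assumes "has_masses \<mu> w" "finite S" "{x. w x \<noteq> 0} \<subseteq> S"
  shows "pos_part \<mu> = point_masses S (\<lambda>x. max 0 (w x))"
proof -
  note \<mu> = has_masses_sum[OF assms]
  have "(SUP B \<in> {B \<in> sets borel. B \<subseteq> A}. \<mu> B) = (\<Sum>x\<in>S. max 0 (w x) * indicator A x)"
    if A: "A \<in> sets borel" for A
  proof (rule cSup_eq_maximum)
    define B where "B = {x\<in>S. w x > 0} \<inter> A"
    have "B \<in> sets borel"
      using assms(2) by (intro borel_closed finite_imp_closed) (simp add: B_def)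
    moreover from this have "\<mu> B = (\<Sum>x\<in>S. max 0 (w x) * indicator A x)"
      by (subst \<mu>) (auto simp: B_def indicator_def intro!: sum.cong)
    ultimately show "(\<Sum>x\<in>S. max 0 (w x) * indicator A x) \<in> \<mu> ` {B \<in> sets borel. B \<subseteq> A}"
      by (intro rev_image_eqI[of B]) (auto simp: B_def)
  next
    fix t assume "t \<in> \<mu> ` {B \<in> sets borel. B \<subseteq> A}"
    then obtain B where B: "B \<in> sets borel" "B \<subseteq> A" "t = \<mu> B" by auto
    show "t \<le> (\<Sum>x\<in>S. max 0 (w x) * indicator A x)"
      unfolding B(3) using B(2)
      by (subst \<mu>[OF B(1)]) (auto simp: indicator_def intro!: sum_mono)
  qed
  then have "pos_part \<mu> =
      measure_of UNIV (sets borel) (emeasure (point_masses S (\<lambda>x. max 0 (w x))))"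
    unfolding pos_part_def using assms(2)
    by (intro measure_of_eq) (auto simp: emeasure_point_masses sets.sigma_sets_eq[of borel, simplified])
  also have "\<dots> = point_masses S (\<lambda>x. max 0 (w x))"
    using measure_of_of_measure[of "point_masses S (\<lambda>x. max 0 (w x))"] by simp
  finally show ?thesis .
qed

lemma neg_part_masses:
  assumes "has_masses \<mu> w" "finite S" "{x. w x \<noteq> 0} \<subseteq> S"
  shows "neg_part \<mu> = point_masses S (\<lambda>x. max 0 (- w x))"
  unfolding neg_part_def
  by (rule pos_part_masses[OF has_masses_uminus[OF assms(1)] assms(2)]) (use assms(3) in simp)

lemma measure_convolution_point_masses:
  assumes "finite S" "finite T" "\<And>x. p x \<ge> 0" "\<And>x. q x \<ge> 0" "A \<in> sets borel"
  shows "measure (convolution (point_masses S p) (point_masses T q)) A =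
    (\<Sum>x\<in>S. \<Sum>y\<in>T. p x * q y * indicator A (x + y))"
proof -
  have [measurable]: "A \<in> sets borel" by fact
  have "emeasure (convolution (point_masses S p) (point_masses T q)) A =
      (\<integral>\<^sup>+x. \<integral>\<^sup>+y. indicator A (x + y) \<partial>point_masses T q \<partial>point_masses S p)"
    by (intro convolution_emeasure' finite_measure_point_masses) (use assms in auto)
  also have "\<dots> = (\<integral>\<^sup>+x. (\<Sum>y\<in>T. ennreal (q y) * indicator A (x + y)) \<partial>point_masses S p)"
    using assms by (intro nn_integral_cong nn_integral_point_masses) auto
  also have "\<dots> = (\<Sum>x\<in>S. ennreal (p x) * (\<Sum>y\<in>T. ennreal (q y) * indicator A (x + y)))"
    using assms(1) by (intro nn_integral_point_masses) measurable
  also have "\<dots> = (\<Sum>x\<in>S. \<Sum>y\<in>T. ennreal (p x * q y * indicator A (x + y)))"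
    unfolding sum_distrib_left
    using assms by (intro sum.cong) (auto simp: indicator_def ennreal_mult)
  also have "\<dots> = ennreal (\<Sum>x\<in>S. \<Sum>y\<in>T. p x * q y * indicator A (x + y))"
    using assms by (simp add: sum_nonneg)
  finally show ?thesis
    using assms by (simp add: measure_def sum_nonneg)
qed

text \<open>Splitting both factors of \<open>w x * v y\<close> into positive and negative parts
  gives exactly the four terms of the bilinear definition.\<close>

lemma signed_convolution_masses:
  assumes \<mu>: "has_masses \<mu> w" "finite S" "{x. w x \<noteq> 0} \<subseteq> S"
    and \<nu>: "has_masses \<nu> v" "finite T" "{x. v x \<noteq> 0} \<subseteq> T"
    and A: "A \<in> sets borel"
  shows "signed_convolution \<mu> \<nu> A = (\<Sum>x\<in>S. \<Sum>y\<in>T. w x * v y * indicator A (x + y))"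
proof -
  have split: "a * b = max 0 a * max 0 b - max 0 a * max 0 (- b)
      - max 0 (- a) * max 0 b + max 0 (- a) * max 0 (- b)" for a b :: real
    by (simp add: max_def)
  have "(\<Sum>x\<in>S. \<Sum>y\<in>T. w x * v y * indicator A (x + y)) =
    (\<Sum>x\<in>S. \<Sum>y\<in>T. max 0 (w x) * max 0 (v y) * indicator A (x + y)
       - max 0 (w x) * max 0 (- v y) * indicator A (x + y)
       - max 0 (- w x) * max 0 (v y) * indicator A (x + y)
       + max 0 (- w x) * max 0 (- v y) * indicator A (x + y))"
    by (subst split) (simp only: distrib_right left_diff_distrib)
  then show ?thesis
    unfolding signed_convolution_def pos_part_masses[OF \<mu>] pos_part_masses[OF \<nu>]
      neg_part_masses[OF \<mu>] neg_part_masses[OF \<nu>]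
    by (simp only: measure_convolution_point_masses \<mu>(2) \<nu>(2) A max.cobounded1
        sum.distrib sum_subtractf)
qed

lemma dirac_eq: "A \<in> sets borel \<Longrightarrow> dirac x A = indicator A x"
  by (simp add: dirac_def measure_return)

lemma has_masses_dirac: "has_masses (dirac c) (\<lambda>x. if x = c then 1 else 0)"
  by (rule has_massesI[of "{c}"]) (auto simp: dirac_eq)

lemma has_masses_bernoulli_step:
  assumes \<mu>: "has_masses \<mu> w" and "h > 0"
  shows "has_masses (signed_convolution \<mu> (\<lambda>A. 1/2 * dirac h A - 1/2 * dirac (- h) A))
    (\<lambda>x. (w (x - h) - w (x + h)) / 2)"
proof -
  define \<nu> where "\<nu> = (\<lambda>A. 1/2 * dirac h A - 1/2 * dirac (- h) A)"
  define v where "v = (\<lambda>x::real. if x = h then 1/2 else if x = - h then - 1/2 else (0::real))"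
  have hne: "h \<noteq> - h" using \<open>h > 0\<close> by simp
  have v: "finite {h, - h}" "{x. v x \<noteq> 0} \<subseteq> {h, - h}" by (auto simp: v_def)
  have \<nu>: "has_masses \<nu> v"
    by (rule has_massesI[OF v]) (use hne in \<open>simp add: \<nu>_def v_def dirac_eq indicator_def\<close>)
  define S where "S = {x. w x \<noteq> 0}"
  have S: "finite S" "{x. w x \<noteq> 0} \<subseteq> S"
    using \<mu> by (auto simp: S_def has_masses_def)
  \<comment> \<open>Moving every atom by \<open>c\<close> shifts the argument of the weight by
    \<open>- c\<close>; \<open>c = h\<close> and \<open>c = - h\<close> give the two halves of the
    convolution.\<close>
  have shift: "((\<lambda>x. w (x - c) * indicator A x) has_sum (\<Sum>x\<in>S. w x * indicator A (x + c))) UNIV"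
    for A :: "real set" and c
  proof -
    have "((\<lambda>x. w x * indicator A (x + c)) has_sum (\<Sum>x\<in>S. w x * indicator A (x + c))) UNIV"
      by (rule has_sum_finite_neutralI[of S]) (use S in auto)
    also have "?this \<longleftrightarrow> ?thesis"
      by (rule has_sum_reindex_bij_witness[of _ "\<lambda>x. x - c" "\<lambda>x. x + c"]) auto
    finally show ?thesis .
  qed
  have "has_masses (signed_convolution \<mu> \<nu>) (\<lambda>x. (w (x - h) - w (x + h)) / 2)"
    unfolding has_masses_def
  proof (intro conjI ballI)
    have "{x. (w (x - h) - w (x + h)) / 2 \<noteq> 0} \<subseteq> (\<lambda>x. x + h) ` S \<union> (\<lambda>x. x - h) ` S"
    proof
      fix x assume "x \<in> {x. (w (x - h) - w (x + h)) / 2 \<noteq> 0}"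
      then have "x - h \<in> S \<or> x + h \<in> S" by (auto simp: S_def)
      then show "x \<in> (\<lambda>x. x + h) ` S \<union> (\<lambda>x. x - h) ` S"
        by (auto simp: image_iff intro: bexI[of _ "x - h"] bexI[of _ "x + h"])
    qed
    then show "finite {x. (w (x - h) - w (x + h)) / 2 \<noteq> 0}"
      by (rule finite_subset) (simp add: S)
    fix A :: "real set" assume A: "A \<in> sets borel"
    have "signed_convolution \<mu> \<nu> A = (\<Sum>x\<in>S. \<Sum>y\<in>{h, - h}. w x * v y * indicator A (x + y))"
      by (rule signed_convolution_masses[OF \<mu> S \<nu> v A])
    also have "\<dots> = 1/2 * (\<Sum>x\<in>S. w x * indicator A (x + h)) +
        (- 1/2) * (\<Sum>x\<in>S. w x * indicator A (x + (- h)))"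
    proof -
      have "(\<Sum>y\<in>{h, - h}. w x * v y * indicator A (x + y)) =
          1/2 * (w x * indicator A (x + h)) + (- 1/2) * (w x * indicator A (x + (- h)))" for x
        using hne by (simp add: v_def del: sum_mult_indicator)
      then show ?thesis by (simp only: sum.distrib sum_distrib_left)
    qed
    also have "((\<lambda>x. 1/2 * (w (x - h) * indicator A x) +
        (- 1/2) * (w (x - (- h)) * indicator A x)) has_sum \<dots>) UNIV"
      by (intro has_sum_add has_sum_cmult_right shift)
    finally show "((\<lambda>x. (w (x - h) - w (x + h)) / 2 * indicator A x) has_sum
        signed_convolution \<mu> \<nu> A) UNIV"
      by (simp add: field_simps)
  qed
  then show ?thesis by (simp add: \<nu>_def)
qed

subsection \<open>Coefficients of the generalised polynomial\<close>

text \<open>The coefficient of \<open>X\<^sup>x\<close> in the generalised polynomial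
  \<open>\<Prod>j<n. 1 - X\<^bsup>b^j\<^esup>\<close>.\<close>

fun coef :: "real \<Rightarrow> nat \<Rightarrow> real \<Rightarrow> real" where
  "coef b 0 x = (if x = 0 then 1 else 0)"
| "coef b (Suc n) x = coef b n x - coef b n (x - b ^ n)"

abbreviation (input) geom :: "real \<Rightarrow> nat \<Rightarrow> real" where
  "geom b n \<equiv> \<Sum>j<n. b ^ j"

lemma finite_coef: "finite {x. coef b n x \<noteq> 0}"
proof (induction n)
  case (Suc n)
  have "{x. coef b (Suc n) x \<noteq> 0} \<subseteq> {x. coef b n x \<noteq> 0} \<union> (\<lambda>x. x + b ^ n) ` {x. coef b n x \<noteq> 0}"
  proof
    fix x assume "x \<in> {x. coef b (Suc n) x \<noteq> 0}"
    then have "coef b n x \<noteq> 0 \<or> coef b n (x - b ^ n) \<noteq> 0" by auto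
    then show "x \<in> {x. coef b n x \<noteq> 0} \<union> (\<lambda>x. x + b ^ n) ` {x. coef b n x \<noteq> 0}"
      by (auto simp: image_iff intro: exI[of _ "x - b ^ n"])
  qed
  then show ?case by (rule finite_subset) (use Suc in auto)
qed auto

text \<open>Substituting \<open>1 / X\<close> for \<open>X\<close> negates each factor up to a power
  of \<open>X\<close>, which yields the sign. On expansions it exchanges the digits \<open>0\<close>
  and \<open>1\<close>.\<close>

lemma coef_reflect: "coef b n (geom b n - x) = (- 1) ^ n * coef b n x"
proof (induction n arbitrary: x)
  case (Suc n)
  have "coef b (Suc n) (geom b (Suc n) - x) =
      coef b n (geom b n - (x - b ^ n)) - coef b n (geom b n - x)"
    by (simp add: algebra_simps)
  then show ?case unfolding Suc by (simp add: algebra_simps)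
qed auto

lemma coef_neg:
  assumes "b > 0" "x < 0" shows "coef b n x = 0"
  using assms(2)
proof (induction n arbitrary: x)
  case (Suc n)
  moreover from Suc(2) have "x - b ^ n < 0" using zero_less_power[OF assms(1), of n] by linarith
  ultimately show ?case by simp
qed auto

lemma coef_above:
  assumes "b > 0" "x > geom b n" shows "coef b n x = 0"
  using coef_reflect[of b n x] coef_neg[OF assms(1), of "geom b n - x"] assms(2) by simp

text \<open>A factor with index at least \<open>k\<close> can contribute to the exponent
  \<open>x\<close> only through its constant term \<open>1\<close>.\<close>

lemma coef_stable:
  assumes "b > 1" "x < b ^ k" "k \<le> n" shows "coef b n x = coef b k x"
  using assms(3)
proof (induction n rule: dec_induct)
  case (step n)
  have "b ^ k \<le> b ^ n" using step assms(1) by (intro power_increasing) auto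
  then have "coef b n (x - b ^ n) = 0" using assms(1,2) by (intro coef_neg) linarith+
  then show ?case using step by simp
qed simp

text \<open>Multiplying \<open>\<Prod>j<n. 1 - X\<^bsup>b^(j+1)\<^esup>\<close> by \<open>1 - X\<close>: the recursion at the lowest digit.\<close>

lemma coef_low_digit:
  assumes "b \<noteq> 0"
  shows "coef b (Suc n) x = coef b n (x / b) - coef b n ((x - 1) / b)"
proof (induction n arbitrary: x)
  case (Suc n)
  have "coef b (Suc (Suc n)) x = coef b (Suc n) x - coef b (Suc n) (x - b ^ Suc n)"
    by (rule coef.simps)
  also have "\<dots> = (coef b n (x / b) - coef b n ((x - 1) / b)) -
      (coef b n ((x - b ^ Suc n) / b) - coef b n ((x - b ^ Suc n - 1) / b))"
    unfolding Suc ..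
  also have "(x - b ^ Suc n) / b = x / b - b ^ n"
    using assms by (simp add: diff_divide_distrib)
  also have "(x - b ^ Suc n - 1) / b = (x - 1) / b - b ^ n"
    using assms by (simp add: diff_divide_distrib)
  finally show ?case by simp
qed (use assms in auto)

definition coef_norm :: "real \<Rightarrow> nat \<Rightarrow> real" where
  "coef_norm b n = (\<Sum>\<^sub>\<infinity>x. \<bar>coef b n x\<bar>)"

lemma coef_norm_affine:
  assumes "d \<noteq> 0"
  shows "((\<lambda>x. \<bar>coef b n (d * x + c)\<bar>) has_sum coef_norm b n) UNIV"
proof -
  have "(\<lambda>x. \<bar>coef b n x\<bar>) summable_on UNIV"
    by (rule summable_on_cong_neutral[THEN iffD1, OF _ _ _ summable_on_finite[OF finite_coef]]) auto
  then have "((\<lambda>x. \<bar>coef b n x\<bar>) has_sum coef_norm b n) UNIV"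
    unfolding coef_norm_def by (rule has_sum_infsum)
  moreover have "((\<lambda>x. \<bar>coef b n (d * x + c)\<bar>) has_sum coef_norm b n) UNIV \<longleftrightarrow>
      ((\<lambda>x. \<bar>coef b n x\<bar>) has_sum coef_norm b n) UNIV"
    using assms
    by (intro has_sum_reindex_bij_witness[of _ "\<lambda>x. (x - c) / d" "\<lambda>x. d * x + c"]) auto
  ultimately show ?thesis by blast
qed

lemma coef_norm_shift:
  "((\<lambda>x. \<bar>coef b n (x - c)\<bar>) has_sum coef_norm b n) UNIV"
  "((\<lambda>x. \<bar>coef b n (x + c)\<bar>) has_sum coef_norm b n) UNIV"
  "((\<lambda>x. \<bar>coef b n x\<bar>) has_sum coef_norm b n) UNIV"
  using coef_norm_affine[of 1 b n "- c"] coef_norm_affine[of 1 b n c] coef_norm_affine[of 1 b n 0]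
  by simp_all

section \<open>Norm recurrence from the equation of the base\<close>

context
  fixes b :: real and m :: nat
  assumes m: "m \<ge> 2" "even m" and b: "b > 1" "b ^ m = geom b m"
begin

text \<open>Scaled by \<open>b ^ K\<close>, the equation of \<open>b\<close> trades \<open>m\<close>
  digits \<open>1\<close> from position \<open>K\<close> upwards for a single \<open>1\<close> at
  position \<open>K + m\<close>.\<close>

lemma geom_add: "geom b (K + m) = geom b K + b ^ (K + m)"
proof -
  have "geom b (K + m) = geom b K + (\<Sum>j<m. b ^ (K + j))"
    by (induction m) auto
  then show ?thesis
    by (simp add: power_add b(2) flip: sum_distrib_left)
qed

lemma geom_closed: "geom b n * (b - 1) = b ^ n - 1"
  using power_diff_1_eq[of b n] by (simp add: mult.commute)

lemma base_eq: "b ^ m * (2 - b) = 1"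
  using geom_closed[of m] b by (simp add: algebra_simps)

lemma base_less_2: "b < 2"
  using base_eq b by (smt (verit) zero_less_power mult_nonneg_nonpos)

text \<open>\<open>b\<close> is at least the golden ratio, the base for \<open>m = 2\<close>:
  putting \<open>b ^ 2\<close> for \<open>b ^ m\<close> in \<open>base_eq\<close> gives an
  inequality from which \<open>b - 1\<close> factors out.\<close>

lemma base_square: "b * (b - 1) \<ge> 1"
proof -
  have "1 = b ^ m * (2 - b)" using base_eq by simp
  also have "\<dots> \<ge> b\<^sup>2 * (2 - b)"
    using m b base_less_2 by (intro mult_right_mono power_increasing) auto
  finally have "0 \<le> (b - 1) * (b * (b - 1) - 1)"
    by (simp add: algebra_simps power2_eq_square)
  then show ?thesis using b by (simp add: zero_le_mult_iff)
qed

text \<open>The closed form is below \<open>b ^ K / (b - 1)\<close>, which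
  \<open>base_square\<close> bounds by \<open>b ^ Suc K\<close>. This excludes digits
  \<open>1\<close> above position \<open>K\<close> in \<open>coef_overlap\<close>.\<close>

lemma geom_less_Suc: "geom b K < b ^ Suc K"
proof -
  have "geom b K * (b - 1) < b ^ K * 1" by (simp add: geom_closed)
  also have "\<dots> \<le> b ^ K * (b * (b - 1))"
    using base_square b by (intro mult_left_mono) auto
  also have "\<dots> = b ^ Suc K * (b - 1)" by simp
  finally show ?thesis using b by (simp only: mult_less_cancel_right)
qed

lemma geom_less_double: "geom b K < 2 * b ^ K"
proof -
  have "geom b K < b * b ^ K" using geom_less_Suc[of K] by (simp only: power_Suc)
  also have "\<dots> \<le> 2 * b ^ K" using base_less_2 b by (intro mult_right_mono) auto
  finally show ?thesis .
qed

text \<open>By \<open>geom_closed\<close> this amounts to \<open>b ^ k * (2 - b) < 1\<close>, and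
  \<open>base_eq\<close> is the case of equality \<open>k = m\<close>.\<close>

lemma geom_less_power:
  assumes "k < m" shows "geom b k < b ^ k"
proof -
  have "b ^ k * (2 - b) < b ^ m * (2 - b)"
    using assms b base_less_2 by (intro mult_strict_right_mono power_strict_increasing) auto
  then have "geom b k * (b - 1) < b ^ k * (b - 1)"
    unfolding geom_closed base_eq by (simp add: algebra_simps)
  then show ?thesis using b by simp
qed

text \<open>For \<open>n < m\<close> nothing cancels: by \<open>geom_less_power\<close> the support
  of \<open>coef b n\<close> ends before that of its translate by \<open>b ^ n\<close>
  begins.\<close>

lemma coef_norm_small: "n \<le> m \<Longrightarrow> coef_norm b n = 2 ^ n"
proof (induction n)
  case 0
  have "((\<lambda>x. \<bar>coef b 0 x\<bar>) has_sum 1) UNIV"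
    by (rule has_sum_finite_neutralI[of "{0}"]) auto
  then show ?case using coef_norm_shift(3) has_sum_unique by fastforce
next
  case (Suc n)
  have "\<bar>coef b (Suc n) x\<bar> = \<bar>coef b n x\<bar> + \<bar>coef b n (x - b ^ n)\<bar>" for x
  proof (cases "x < b ^ n")
    case True
    then show ?thesis using coef_neg[of b "x - b ^ n" n] b by simp
  next
    case False
    then show ?thesis using coef_above[of b n x] b geom_less_power[of n] Suc(2) by simp
  qed
  then have "((\<lambda>x. \<bar>coef b (Suc n) x\<bar>) has_sum coef_norm b n + coef_norm b n) UNIV"
    by (simp only:) (intro has_sum_add coef_norm_shift)
  then have "coef_norm b (Suc n) = coef_norm b n + coef_norm b n"
    using coef_norm_shift(3) has_sum_unique by blast
  then show ?case using Suc by simp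
qed

text \<open>A number with two expansions of length \<open>K + m + 1\<close> starting with the digits \<open>1\<close> and
  \<open>0\<close> has the forms \<open>1 0^{m-1} v\<close> and \<open>0 1^{m-1} v'\<close>; as \<open>m - 1\<close> is odd, the two coefficients
  pick up opposite signs.\<close>

lemma coef_overlap:
  assumes "0 \<le> y" "y \<le> geom b K"
  shows "coef b (K + m) y = coef b (Suc K) y"
    and "coef b (K + m) (y + b ^ (K + m)) = - coef b (Suc K) (y + b ^ K)"
proof -
  have less: "geom b K < b ^ Suc K" by (rule geom_less_Suc)
  have stable: "coef b (K + m) z = coef b (Suc K) z" if "z \<le> geom b K" for z
    using that less m b by (intro coef_stable) auto
  show "coef b (K + m) y = coef b (Suc K) y" by (rule stable) fact
  \<comment> \<open>Reflection turns the leading digits \<open>1\<close> into \<open>0\<close>, so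
    that \<open>stable\<close> can delete them; a second reflection, now in \<open>Suc K\<close>
    digits, undoes the first up to sign.\<close>
  have "coef b (K + m) (y + b ^ (K + m)) = coef b (K + m) (geom b (K + m) - (geom b K - y))"
    by (simp add: geom_add add.commute)
  also have "\<dots> = (- 1) ^ K * coef b (Suc K) (geom b K - y)"
    unfolding coef_reflect using m assms by (simp add: stable power_add)
  also have "geom b K - y = geom b (Suc K) - (y + b ^ K)" by simp
  also have "coef b (Suc K) \<dots> = (- 1) ^ Suc K * coef b (Suc K) (y + b ^ K)"
    by (rule coef_reflect)
  finally show "coef b (K + m) (y + b ^ (K + m)) = - coef b (Suc K) (y + b ^ K)"
    by (simp flip: mult.assoc power_mult_distrib)
qed

text \<open>This is the norm recurrence before summation over \<open>y\<close>. \<open>F\<close> and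
  \<open>G\<close> belong to top digit \<open>0\<close> and \<open>1\<close>; \<open>U\<close> and
  \<open>V\<close> arise by deleting the forced prefixes. Both pairs lose equally much by
  cancellation, and \<open>U + V = P - R\<close>, where \<open>P\<close> and \<open>R\<close> never
  meet.\<close>

lemma coef_cancellation:
  fixes y :: real and K :: nat
  defines "F \<equiv> coef b (K + m) (y + b ^ (K + m))" and "G \<equiv> coef b (K + m) y"
    and "U \<equiv> coef b (Suc K) (y + b ^ K)" and "V \<equiv> coef b (Suc K) y"
    and "P \<equiv> coef b K (y + b ^ K)" and "R \<equiv> coef b K (y - b ^ K)"
  shows "\<bar>F - G\<bar> + \<bar>U\<bar> + \<bar>V\<bar> = \<bar>F\<bar> + \<bar>G\<bar> + \<bar>P\<bar> + \<bar>R\<bar>"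
proof -
  define Q where "Q = coef b K y"
  have U: "U = P - Q" and V: "V = Q - R"
    by (simp_all add: U_def V_def P_def Q_def R_def)
  \<comment> \<open>The arguments of \<open>P\<close> and \<open>R\<close> differ by
    \<open>2 * b ^ K\<close>, more than the length \<open>geom b K\<close> of the interval carrying
    \<open>coef b K\<close>.\<close>
  have "P = 0 \<or> R = 0"
  proof (rule ccontr)
    assume "\<not> ?thesis"
    then have "y + b ^ K \<le> geom b K" "y - b ^ K \<ge> 0"
      using coef_above[of b K "y + b ^ K"] coef_neg[of b "y - b ^ K" K] b
      by (force simp: P_def R_def)+
    then show False using geom_less_double[of K] by linarith
  qed
  then have loss: "\<bar>U\<bar> + \<bar>V\<bar> - \<bar>P\<bar> - \<bar>R\<bar> = \<bar>U\<bar> + \<bar>V\<bar> - \<bar>U + V\<bar>"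
    by (auto simp: U V)
  have "\<bar>F\<bar> + \<bar>G\<bar> - \<bar>F - G\<bar> = \<bar>U\<bar> + \<bar>V\<bar> - \<bar>U + V\<bar>"
  proof -
    \<comment> \<open>Outside the middle range one of \<open>F\<close>, \<open>G\<close> and one of
      \<open>U\<close>, \<open>V\<close> vanish, so both losses are zero.\<close>
    consider "y < 0" | "0 \<le> y" "y \<le> geom b K" | "y > geom b K" by linarith
    then show ?thesis
    proof cases
      case 1
      then have "G = 0" "V = 0"
        unfolding G_def V_def using b by (auto intro!: coef_neg simp del: coef.simps)
      then show ?thesis by simp
    next
      case 2
      then have "F = - U" "G = V" using coef_overlap by (auto simp: F_def G_def U_def V_def)
      then show ?thesis by simp
    next
      case 3
      have "F = 0" unfolding F_def using b 3 by (intro coef_above) (auto simp: geom_add)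
      moreover have "U = 0" unfolding U_def using b 3 by (intro coef_above) auto
      ultimately show ?thesis by simp
    qed
  qed
  with loss show ?thesis by linarith
qed

text \<open>Each term of \<open>coef_cancellation\<close> is a translated coefficient function, with
  \<open>F - G\<close> belonging to \<open>K + m + 1\<close> factors, so summing over
  \<open>y\<close> turns each into a norm.\<close>

lemma coef_norm_rec:
  "coef_norm b (K + m + 1) = 2 * coef_norm b (K + m) - 2 * coef_norm b (K + 1) + 2 * coef_norm b K"
proof -
  let ?F = "\<lambda>y. coef b (K + m) (y + b ^ (K + m))" and ?G = "coef b (K + m)"
  have "((\<lambda>y. \<bar>?F y - ?G y\<bar>) has_sum coef_norm b (K + m + 1)) UNIV"
    using coef_norm_shift(2)[of b "Suc (K + m)" "b ^ (K + m)"] by simp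
  then have "((\<lambda>y. \<bar>?F y - ?G y\<bar> + \<bar>coef b (Suc K) (y + b ^ K)\<bar> + \<bar>coef b (Suc K) y\<bar>) has_sum
      coef_norm b (K + m + 1) + coef_norm b (Suc K) + coef_norm b (Suc K)) UNIV"
    by (intro has_sum_add coef_norm_shift)
  moreover have "((\<lambda>y. \<bar>?F y\<bar> + \<bar>?G y\<bar> + \<bar>coef b K (y + b ^ K)\<bar> + \<bar>coef b K (y - b ^ K)\<bar>) has_sum
      coef_norm b (K + m) + coef_norm b (K + m) + coef_norm b K + coef_norm b K) UNIV"
    by (intro has_sum_add coef_norm_shift)
  ultimately have "coef_norm b (K + m + 1) + coef_norm b (Suc K) + coef_norm b (Suc K) =
      coef_norm b (K + m) + coef_norm b (K + m) + coef_norm b K + coef_norm b K"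
    unfolding coef_cancellation by (rule has_sum_unique)
  then show ?thesis by simp
qed

end

section \<open>From Bernoulli convolutions to coefficients\<close>

text \<open>The affine map turns the sign \<open>e_j\<close> into the digit
  \<open>(1 + e_j) / 2\<close> at position \<open>n - j\<close>. Each digit carries opposite signs
  in \<open>coef\<close> and in the convolution, whence \<open>(- 1) ^ n\<close>. The newest sign
  becomes the lowest digit, hence the use of \<open>coef_low_digit\<close>.\<close>

lemma has_masses_signed_bernoulli:
  assumes "b > 0"
  shows "has_masses (signed_bernoulli b n)
    (\<lambda>x. (- 1/2) ^ n * coef b n ((b ^ n * x + geom b n) / 2))"
proof (induction n)
  case 0
  then show ?case using has_masses_dirac[of 0] by simp
next
  case (Suc n)
  let ?u = "\<lambda>n x. (b ^ n * x + geom b n) / 2"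
  define h where "h = 1 / b ^ Suc n"
  have "h > 0" using assms by (simp add: h_def)
  have geom: "geom b (Suc n) = b * geom b n + 1"
    unfolding sum.lessThan_Suc_shift by (simp add: sum_distrib_left)
  have "((- 1/2) ^ n * coef b n (?u n (x - h)) - (- 1/2) ^ n * coef b n (?u n (x + h))) / 2 =
      (- 1/2) ^ Suc n * coef b (Suc n) (?u (Suc n) x)" for x
  proof -
    have "?u (Suc n) x / b = ?u n (x + h)" "(?u (Suc n) x - 1) / b = ?u n (x - h)"
      unfolding geom using assms by (simp_all add: h_def field_simps)
    moreover have "b \<noteq> 0" using assms by simp
    ultimately have "coef b (Suc n) (?u (Suc n) x) = coef b n (?u n (x + h)) - coef b n (?u n (x - h))"
      by (subst coef_low_digit) (assumption, simp only:)
    moreover have "((- 1/2) ^ n * p - (- 1/2) ^ n * q) / 2 = (- 1/2) ^ Suc n * (q - p)" for p q :: real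
      by (simp add: algebra_simps diff_divide_distrib)
    ultimately show ?thesis by (simp only:)
  qed
  then show ?case
    using has_masses_bernoulli_step[OF Suc \<open>h > 0\<close>] by (simp add: h_def del: coef.simps)
qed

lemma tv_norm_signed_bernoulli:
  assumes "b > 0"
  shows "2 ^ n * tv_norm (signed_bernoulli b n) = coef_norm b n"
proof -
  have "((\<lambda>x. 2 ^ n * \<bar>(- 1/2) ^ n * coef b n ((b ^ n * x + geom b n) / 2)\<bar>) has_sum
      2 ^ n * tv_norm (signed_bernoulli b n)) UNIV"
    by (intro has_sum_cmult_right tv_norm_masses has_masses_signed_bernoulli assms)
  moreover have "2 ^ n * \<bar>(- 1/2) ^ n * coef b n ((b ^ n * x + geom b n) / 2)\<bar> =
      \<bar>coef b n (b ^ n / 2 * x + geom b n / 2)\<bar>" for x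
    by (simp add: abs_mult power_abs power_one_over add_divide_distrib flip: mult.assoc)
  moreover have "((\<lambda>x. \<bar>coef b n (b ^ n / 2 * x + geom b n / 2)\<bar>) has_sum coef_norm b n) UNIV"
    using assms by (intro coef_norm_affine) simp
  ultimately show ?thesis
    using has_sum_unique by fastforce
qed

subsection \<open>Asymptotics of the recurrence\<close>

text \<open>The coefficients on the right sum to \<open>1\<close>, so constants solve the recurrence
  and the increments \<open>c\<close> satisfy one of order \<open>m\<close>, contracting by the
  third condition in \<open>st\<close>.\<close>

lemma recurrence_limit:
  fixes r :: "nat \<Rightarrow> real"
  assumes m: "m \<ge> 1" and st: "s \<ge> 0" "t \<ge> 0" "(real m - 1) * s + t < 1"
    and rec: "\<And>n. r (n + m + 1) = (1 + s) * r (n + m) - (s + t) * r (n + 1) + t * r n"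
    and init: "\<And>n. n \<le> m \<Longrightarrow> r n = (1 + s) ^ n"
  shows "\<exists>C>0. r \<longlonglongrightarrow> C"
proof -
  define \<theta> where "\<theta> = (real m - 1) * s + t"
  define c where "c = (\<lambda>n. r (Suc n) - r n)"
  have telescope: "(\<Sum>k\<in>{1..<m}. c (n + k)) = r (n + m) - r (n + 1)" for n
    using sum_Suc_diff'[of 1 m "\<lambda>k. r (n + k)"] m by (simp add: c_def)
  have c_rec: "c (n + m) = s * (\<Sum>k\<in>{1..<m}. c (n + k)) - t * c n" for n
    unfolding telescope using rec[of n] by (simp add: c_def algebra_simps)
  have \<theta>: "0 \<le> \<theta>" "\<theta> < 1"
    using st m by (auto simp: \<theta>_def)
  \<comment> \<open>The partial sum is bounded in terms of itself: \<open>?S (N + m)\<close> is at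
    most \<open>?S m + \<theta> * ?S (N + m)\<close>, and \<open>\<theta> < 1\<close>.\<close>
  have "(\<Sum>n<N. \<bar>c n\<bar>) \<le> (\<Sum>n<m. \<bar>c n\<bar>) / (1 - \<theta>)" for N
  proof -
    let ?S = "\<lambda>N. \<Sum>n<N. \<bar>c n\<bar>"
    have window: "(\<Sum>n<N. \<bar>c (n + k)\<bar>) \<le> ?S (N + m)" if "k \<le> m" for k
    proof -
      have "(\<Sum>n<N. \<bar>c (n + k)\<bar>) = (\<Sum>n\<in>{k..<N + k}. \<bar>c n\<bar>)"
        using sum.shift_bounds_nat_ivl[of "\<lambda>n. \<bar>c n\<bar>" 0 k N] by (simp add: lessThan_atLeast0)
      also have "\<dots> \<le> ?S (N + m)"
        using that by (intro sum_mono2) auto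
      finally show ?thesis .
    qed
    have "(\<Sum>n<N. \<bar>c (n + m)\<bar>) \<le> (\<Sum>n<N. s * (\<Sum>k\<in>{1..<m}. \<bar>c (n + k)\<bar>) + t * \<bar>c n\<bar>)"
    proof (rule sum_mono)
      fix n
      have "\<bar>c (n + m)\<bar> \<le> s * \<bar>\<Sum>k\<in>{1..<m}. c (n + k)\<bar> + t * \<bar>c n\<bar>"
        unfolding c_rec
        using abs_triangle_ineq4[of "s * (\<Sum>k\<in>{1..<m}. c (n + k))" "t * c n"] st
        by (simp add: abs_mult)
      also have "s * \<bar>\<Sum>k\<in>{1..<m}. c (n + k)\<bar> \<le> s * (\<Sum>k\<in>{1..<m}. \<bar>c (n + k)\<bar>)"
        using st by (intro mult_left_mono sum_abs) auto
      finally show "\<bar>c (n + m)\<bar> \<le> s * (\<Sum>k\<in>{1..<m}. \<bar>c (n + k)\<bar>) + t * \<bar>c n\<bar>" by simp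
    qed
    also have "\<dots> = s * (\<Sum>k\<in>{1..<m}. \<Sum>n<N. \<bar>c (n + k)\<bar>) + t * (\<Sum>n<N. \<bar>c (n + 0)\<bar>)"
      by (subst sum.swap) (simp add: sum.distrib sum_distrib_left)
    also have "\<dots> \<le> s * (\<Sum>k\<in>{1..<m}. ?S (N + m)) + t * ?S (N + m)"
      using st by (intro add_mono mult_left_mono sum_mono window) auto
    also have "\<dots> = \<theta> * ?S (N + m)"
      using m by (simp add: \<theta>_def algebra_simps of_nat_diff)
    finally have "(\<Sum>n<N. \<bar>c (n + m)\<bar>) \<le> \<theta> * ?S (N + m)" .
    moreover have "?S (N + m) = ?S m + (\<Sum>n<N. \<bar>c (n + m)\<bar>)"
      by (induction N) auto
    ultimately have "?S (N + m) * (1 - \<theta>) \<le> ?S m"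
      by (simp add: algebra_simps)
    then have "?S (N + m) \<le> ?S m / (1 - \<theta>)"
      using \<theta> by (simp add: pos_le_divide_eq)
    moreover have "?S N \<le> ?S (N + m)"
      by (intro sum_mono2) auto
    ultimately show ?thesis by linarith
  qed
  then have "summable (\<lambda>n. \<bar>c n\<bar>)"
    by (intro summableI_nonneg_bounded) auto
  then have "summable c" by (rule summable_rabs_cancel)
  then have "(\<lambda>n. \<Sum>k<n. c k) \<longlonglongrightarrow> suminf c" by (rule summable_LIMSEQ)
  then have "(\<lambda>n. r n - r 0) \<longlonglongrightarrow> suminf c"
    by (simp add: c_def sum_lessThan_telescope)
  from tendsto_add[OF this tendsto_const[of "r 0"]]
  obtain C where C: "r \<longlonglongrightarrow> C" by auto
  \<comment> \<open>The differences of \<open>I\<close> are \<open>c_rec\<close> with all terms on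
    one side, so \<open>I\<close> is constant; comparing its initial value with its limit determines
    \<open>C\<close>.\<close>
  define I where "I = (\<lambda>n. r (n + m) - s * (\<Sum>k\<in>{1..<m}. r (n + k)) + t * r n)"
  have "I (Suc n) = I n" for n
  proof -
    have "(\<Sum>k\<in>{1..<m}. r (Suc n + k)) - (\<Sum>k\<in>{1..<m}. r (n + k)) = r (n + m) - r (n + 1)"
      using telescope[of n] by (simp add: c_def sum_subtractf)
    then have "s * (\<Sum>k\<in>{1..<m}. r (Suc n + k)) =
        s * (\<Sum>k\<in>{1..<m}. r (n + k)) + s * (r (n + m) - r (n + 1))"
      by (metis add.commute diff_add_cancel distrib_left)
    then show ?thesis
      using rec[of n] by (simp add: I_def algebra_simps)
  qed
  then have I_const: "I n = I 0" for n by (induction n) auto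
  \<comment> \<open>The initial values are geometric with ratio \<open>1 + s\<close>, so
    \<open>s * r k\<close> is an increment of \<open>r\<close> and the sum telescopes.\<close>
  have "s * (\<Sum>k\<in>{1..<m}. r (0 + k)) = (\<Sum>k\<in>{1..<m}. r (Suc k) - r k)"
    unfolding sum_distrib_left by (rule sum.cong) (auto simp: init algebra_simps)
  also have "\<dots> = r m - r 1"
    using sum_Suc_diff'[of 1 m r] m by simp
  finally have I0: "I 0 = 1 + s + t"
    using m init[of 0] init[of 1] by (simp add: I_def)
  have "I \<longlonglongrightarrow> C - s * (\<Sum>k\<in>{1..<m}. C) + t * C"
    unfolding I_def by (intro tendsto_intros LIMSEQ_ignore_initial_segment C)
  moreover have "I \<longlonglongrightarrow> 1 + s + t"
    using I_const I0 by (subst tendsto_cong[of I "\<lambda>_. 1 + s + t"]) auto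
  ultimately have "C - s * (\<Sum>k\<in>{1..<m}. C) + t * C = 1 + s + t"
    using LIMSEQ_unique by blast
  then have "C * (1 - (real m - 1) * s + t) = 1 + s + t"
    using m by (simp add: algebra_simps of_nat_diff)
  moreover have "1 - (real m - 1) * s + t > 0" "1 + s + t > 0"
    using st by auto
  ultimately have "C > 0"
    by (metis zero_less_mult_pos2)
  with C show ?thesis by blast
qed

section \<open>The characteristic root\<close>

text \<open>This serves twice: for the uniqueness of the root, and, divided by
  \<open>l ^ (m + 1)\<close>, as the contraction condition of \<open>recurrence_limit\<close>. The
  bound \<open>3/2\<close> makes the case \<open>m = 2\<close> work, since
  \<open>9/4 > 2\<close>.\<close>

lemma power_Suc_gt_affine:
  fixes l :: real
  assumes "m \<ge> 2" "l \<ge> 3/2"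
  shows "l ^ (m + 1) > 2 * (real m - 1) * (l - 1) + 2"
  using assms(1)
proof (induction m rule: dec_induct)
  case base
  have "l * (3/2 * (3/2)) \<le> l * (l * l)"
    using assms(2) by (intro mult_left_mono mult_mono) auto
  then show ?case using assms(2) by (simp add: numeral_eq_Suc algebra_simps)
next
  case (step n)
  have "2 * (real (Suc n) - 1) * (l - 1) + 2 \<le> l * (2 * (real n - 1) * (l - 1) + 2)"
  proof -
    have "0 \<le> (real n - 1) * (l - 1) * (l - 1)"
      using step assms(2) by auto
    then show ?thesis by (simp add: algebra_simps)
  qed
  also have "\<dots> < l * l ^ (n + 1)"
    using step assms(2) by (intro mult_strict_left_mono) auto
  finally show ?case by simp
qed

text \<open>As \<open>x ^ m\<close> is nonnegative for even \<open>m\<close>, the equation confines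
  \<open>x\<close> between \<open>1\<close> and \<open>2\<close>. Up to \<open>3/2\<close> the left
  side is too large already with exponent \<open>2\<close>.\<close>

lemma root_gt_three_halves:
  fixes x :: real
  assumes "m \<ge> 2" "even m" "x ^ m * (2 - x) = 2 * (x - 1)"
  shows "3/2 < x" "x < 2"
proof -
  have nonneg: "x ^ m \<ge> 0" using assms(2) by (simp add: zero_le_even_power)
  have "x > 1"
  proof (rule ccontr)
    assume "\<not> x > 1"
    then have "2 * (x - 1) \<ge> 0" unfolding assms(3)[symmetric] using nonneg by auto
    then have "x = 1" using \<open>\<not> x > 1\<close> by simp
    then show False using assms(3) by simp
  qed
  show "x < 2"
  proof (rule ccontr)
    assume "\<not> x < 2"
    then have "2 * (x - 1) \<le> 0"
      unfolding assms(3)[symmetric] using nonneg by (simp add: mult_nonneg_nonpos)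
    then show False using \<open>\<not> x < 2\<close> by simp
  qed
  show "3/2 < x"
  proof (rule ccontr)
    assume "\<not> 3/2 < x"
    have "x\<^sup>2 * (2 - x) \<le> x ^ m * (2 - x)"
      using \<open>x > 1\<close> \<open>x < 2\<close> assms(1) by (intro mult_right_mono power_increasing) auto
    moreover have "x\<^sup>2 * (2 - x) > 2 * (x - 1)"
    proof -
      define d where "d = x - 1"
      have d: "0 < d" "d \<le> 1/2" using \<open>x > 1\<close> \<open>\<not> 3/2 < x\<close> by (auto simp: d_def)
      have "d * d \<le> 1/2 * (1/2)" using d by (intro mult_mono) auto
      moreover have "d * d * d \<le> 1/4 * (1/2)" using d calculation by (intro mult_mono) auto
      ultimately have "1 - d - d * d - d * d * d > 0" using d by linarith
      moreover have "x = 1 + d" by (simp add: d_def)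
      ultimately show ?thesis by (simp add: power2_eq_square algebra_simps)
    qed
    ultimately show False using assms(3) by simp
  qed
qed

text \<open>The difference of the two equations is \<open>x - l\<close> times a factor shown to be
  positive, using that \<open>x ^ m - l ^ m\<close> is at most
  \<open>(x - l) * m * x ^ (m - 1)\<close>.\<close>

lemma root_unique_above:
  fixes l x :: real
  assumes m: "m \<ge> 2" "even m" and l: "l ^ m * (2 - l) = 2 * (l - 1)"
    and x: "x ^ m * (2 - x) = 2 * (x - 1)" "l < x"
  shows False
proof -
  note l' = root_gt_three_halves[OF m l]
  obtain k where k: "m = Suc k" using m by (cases m) auto
  have "x ^ m - l ^ m = (x - l) * (\<Sum>p<m. x ^ p * l ^ (k - p))"
    unfolding k by (rule diff_power_eq_sum)
  also have "\<dots> \<le> (x - l) * (\<Sum>p<m. x ^ k)"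
  proof (intro mult_left_mono sum_mono)
    fix p assume "p \<in> {..<m}"
    then have "x ^ k = x ^ p * x ^ (k - p)" by (simp add: k flip: power_add)
    then show "x ^ p * l ^ (k - p) \<le> x ^ k"
      using l' x(2) by (auto intro!: mult_left_mono power_mono)
  qed (use x in auto)
  finally have "(2 - l) * (x ^ m - l ^ m) \<le> (2 - l) * ((x - l) * (real m * x ^ k))"
    using l' by (intro mult_left_mono) auto
  moreover have "x ^ m * (x - l) - (2 - l) * (x ^ m - l ^ m) + 2 * (x - l) = 0"
    using l x by (simp add: algebra_simps)
  ultimately have "(x - l) * (x ^ k * (x - (2 - l) * real m) + 2) \<le> 0"
    by (simp add: k algebra_simps)
  \<comment> \<open>It suffices that \<open>(2 - l) * m\<close> is at most \<open>l\<close>;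
    multiplied by \<open>l ^ m\<close>, this follows from \<open>power_Suc_gt_affine\<close> and the
    equation of \<open>l\<close>.\<close>
  moreover have "x ^ k * (x - (2 - l) * real m) \<ge> 0"
  proof -
    have "l ^ m * l = l ^ (m + 1)" by simp
    also have "\<dots> \<ge> 2 * (real m - 1) * (l - 1) + 2"
      using power_Suc_gt_affine[OF m(1), of l] l' by simp
    also have "2 * (real m - 1) * (l - 1) + 2 \<ge> real m * (2 * (l - 1))"
      using l' by (simp add: algebra_simps)
    also have "real m * (2 * (l - 1)) = l ^ m * ((2 - l) * real m)"
      unfolding l[symmetric] by simp
    finally have "(2 - l) * real m \<le> l" using l' by simp
    then show ?thesis using x(2) l' by auto
  qed
  ultimately show False
    using x(2) by (smt (verit) mult_pos_pos)
qed

lemma root_exists: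
  assumes "m \<ge> 2"
  shows "\<exists>l::real. l ^ m * (2 - l) = 2 * (l - 1)"
proof -
  let ?p = "\<lambda>x::real. x ^ m * (2 - x) - 2 * (x - 1)"
  \<comment> \<open>At \<open>3/2\<close> the first term of \<open>?p\<close> is at least
    \<open>9/8\<close> and the subtracted one is \<open>1\<close>.\<close>
  have "(3/2::real) ^ 2 \<le> (3/2) ^ m" using assms by (intro power_increasing) auto
  then have "?p (3/2) \<ge> 0" by (simp add: power2_eq_square)
  moreover have "?p 2 \<le> 0" by simp
  ultimately have "\<exists>x\<ge>3/2. x \<le> 2 \<and> ?p x = 0"
    by (intro IVT2') (auto intro!: continuous_intros)
  then show ?thesis by auto
qed

lemma recurrence_asymptotics:
  fixes a :: "nat \<Rightarrow> real"
  assumes m: "m \<ge> 2" "even m"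
    and init: "\<And>n. n \<le> m \<Longrightarrow> a n = 2 ^ n"
    and rec: "\<And>n. a (n + m + 1) = 2 * a (n + m) - 2 * a (n + 1) + 2 * a n"
  shows "\<exists>l. 1 < l \<and> l < 2 \<and> (\<forall>x::real. x ^ (m + 1) = 2 * x ^ m - 2 * x + 2 \<longleftrightarrow> x = l) \<and>
    (\<exists>C>0. (\<lambda>n. a n / l ^ n) \<longlonglongrightarrow> C)"
proof -
  have char: "x ^ (m + 1) = 2 * x ^ m - 2 * x + 2 \<longleftrightarrow> x ^ m * (2 - x) = 2 * (x - 1)" for x :: real
    by (auto simp: algebra_simps)
  obtain l :: real where l: "l ^ m * (2 - l) = 2 * (l - 1)"
    using root_exists[OF m(1)] by blast
  note l' = root_gt_three_halves[OF m l]
  have unique: "x ^ (m + 1) = 2 * x ^ m - 2 * x + 2 \<longleftrightarrow> x = l" for x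
    unfolding char using l root_unique_above[OF m] by (metis linorder_neqE_linordered_idom)
  \<comment> \<open>Division by \<open>l ^ (n + m + 1)\<close> turns the three coefficients into
    \<open>2 / l\<close>, \<open>2 / l ^ m\<close> and \<open>2 / l ^ (m + 1)\<close>. They have the
    shape \<open>1 + s\<close>, \<open>s + t\<close>, \<open>t\<close> because \<open>l\<close> is a
    root.\<close>
  define s t r where "s = 2 / l - 1" and "t = 2 / l ^ (m + 1)" and "r = (\<lambda>n. a n / l ^ n)"
  have st: "s + t = 2 / l ^ m"
  proof -
    have "l ^ m * (2 - l) + 2 = 2 * l" unfolding l by simp
    then have "(l ^ m * (2 - l) + 2) / l ^ (m + 1) = 2 / l ^ m" using l' by simp
    moreover have "s = l ^ m * (2 - l) / l ^ (m + 1)"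
      using l' by (simp add: s_def diff_divide_distrib)
    ultimately show ?thesis by (simp add: t_def add_divide_distrib)
  qed
  have "\<exists>C>0. r \<longlonglongrightarrow> C"
  proof (rule recurrence_limit[of m s t])
    show "(real m - 1) * s + t < 1"
    proof -
      have "s = 2 * (l - 1) / l ^ (m + 1)"
      proof -
        have "s = l ^ m * (2 - l) / l ^ (m + 1)"
          using l' by (simp add: s_def diff_divide_distrib)
        then show ?thesis unfolding l .
      qed
      then have "(real m - 1) * s + t = (2 * (real m - 1) * (l - 1) + 2) / l ^ (m + 1)"
        by (simp only: t_def add_divide_distrib times_divide_eq_right mult.assoc mult.left_commute)
      also have "\<dots> < 1"
        using power_Suc_gt_affine[OF m(1), of l] l' by (subst divide_less_eq_1_pos) auto
      finally show ?thesis .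
    qed
    show "r (n + m + 1) = (1 + s) * r (n + m) - (s + t) * r (n + 1) + t * r n" for n
    proof -
      have "(1 + s) * r (n + m) = 2 * a (n + m) / l ^ (n + m + 1)"
        using l' by (simp add: s_def r_def)
      moreover have "(s + t) * r (n + 1) = 2 * a (n + 1) / l ^ (n + m + 1)"
        unfolding st by (simp add: r_def power_add)
      moreover have "t * r n = 2 * a n / l ^ (n + m + 1)"
        by (simp add: t_def r_def power_add)
      ultimately show ?thesis
        using rec[of n]
        by (simp only:) (simp add: r_def diff_divide_distrib add_divide_distrib)
    qed
    show "r n = (1 + s) ^ n" if "n \<le> m" for n
      using that l' by (simp add: r_def s_def init power_divide)
  qed (use m l' in \<open>auto simp: s_def t_def\<close>)
  with unique l' show ?thesis by (intro exI[of _ l]) (auto simp: r_def)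
qed

theorem theorem1:
  fixes m :: nat and \<beta> :: real and a :: "nat \<Rightarrow> real"
  assumes "m \<ge> 2" and "even m"
    and "\<beta> > 1" and "\<beta> ^ m = (\<Sum>k<m. \<beta> ^ k)"
    and a_def: "\<And>n. a n = 2 ^ n * tv_norm (signed_bernoulli \<beta> n)"
  shows "(\<forall>n. a n = (if n \<le> m then 2 ^ n
                     else 2 * a (n - 1) - 2 * a (n - m) + 2 * a (n - m - 1))) \<and>
    (\<exists>l::real. 1 < l \<and> l < 2 \<and>
       (\<forall>x::real. x ^ (m + 1) = 2 * x ^ m - 2 * x + 2 \<longleftrightarrow> x = l) \<and>
       (\<exists>C>0. (\<lambda>n. tv_norm (signed_bernoulli \<beta> n) / (C * (l / 2) ^ n)) \<longlonglongrightarrow> 1))"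
proof -
  have a: "a n = coef_norm \<beta> n" for n
    using tv_norm_signed_bernoulli[of \<beta> n] assms(3) by (simp add: a_def)
  have init: "a n = 2 ^ n" if "n \<le> m" for n
    unfolding a using coef_norm_small[OF assms(1-4) that] .
  have rec: "a (n + m + 1) = 2 * a (n + m) - 2 * a (n + 1) + 2 * a n" for n
    unfolding a using coef_norm_rec[OF assms(1-4)] .
  have "\<forall>n. a n = (if n \<le> m then 2 ^ n else 2 * a (n - 1) - 2 * a (n - m) + 2 * a (n - m - 1))"
  proof
    fix n
    show "a n = (if n \<le> m then 2 ^ n else 2 * a (n - 1) - 2 * a (n - m) + 2 * a (n - m - 1))"
    proof (cases "n \<le> m")
      case False
      then obtain k where "n = k + m + 1"
        by (metis Suc_eq_plus1 add.commute add_Suc_right less_iff_Suc_add not_le)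
      then show ?thesis using rec[of k] by simp
    qed (simp add: init)
  qed
  moreover obtain l C where l: "1 < l" "l < 2"
      "\<forall>x::real. x ^ (m + 1) = 2 * x ^ m - 2 * x + 2 \<longleftrightarrow> x = l"
    and C: "C > 0" "(\<lambda>n. a n / l ^ n) \<longlonglongrightarrow> C"
    using recurrence_asymptotics[OF assms(1,2) init rec] by blast
  \<comment> \<open>The factor \<open>2 ^ n\<close> in \<open>a n\<close> is absorbed into
    \<open>(l / 2) ^ n\<close>, so the same \<open>C\<close> serves for the norms.\<close>
  have "(\<lambda>n. a n / l ^ n / C) \<longlonglongrightarrow> C / C"
    using C by (intro tendsto_intros) auto
  then have "(\<lambda>n. tv_norm (signed_bernoulli \<beta> n) / (C * (l / 2) ^ n)) \<longlonglongrightarrow> 1"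
    using C(1) by (simp add: a_def power_divide field_simps)
  ultimately show ?thesis using l C(1) by blast
qed

end
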